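(* Let $Q$ be a finite quandle and let $\rho : Q \to GL(V)$ be an irreducible finite dimensional complex quandle representation of $Q$. Then $\rho$ is unitary for some inner product on $V$ if and only if the determinant of every element of $\rho(Q)$ has modulus $1$.
   Context: A quandle is a set $Q$ with a binary operation $\triangleright$ such that: $x\triangleright x=x$ for all $x\in Q$; for all $x,y\in Q$ there is a unique $z\in Q$ with $x\triangleright z=y$; and $x\triangleright(y\triangleright z)=(x\triangleright y)\triangleright(x\triangleright z)$ for all $x,y,z\in Q$. A quandle representation of $Q$ on a vector space $V$ is a map $\rho:Q\to GL(V)$ with $\rho(x\triangleright y)=\rho(x)\rho(y)\rho(x)^{-1}$ for all $x,y\in Q$. It is irreducible if the only vector subspaces of $V$ stable under all elements of $\rho(Q)$ are $0$ and $V$. It is unitary for an inner product on $V$ if all elements of $\rho(Q)$ are isometries for that inner product. *)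

theory Defs
  imports Complex_Main "Jordan_Normal_Form.Determinant"
begin

locale quandle =
  fixes Q :: "'q set" and op :: "'q \<Rightarrow> 'q \<Rightarrow> 'q" (infixr "\<triangleright>" 70)
  assumes closed: "x \<in> Q \<Longrightarrow> y \<in> Q \<Longrightarrow> x \<triangleright> y \<in> Q"
    and idem: "x \<in> Q \<Longrightarrow> x \<triangleright> x = x"
    and unique_solution: "x \<in> Q \<Longrightarrow> y \<in> Q \<Longrightarrow> \<exists>!z. z \<in> Q \<and> x \<triangleright> z = y"
    and self_distrib: "x \<in> Q \<Longrightarrow> y \<in> Q \<Longrightarrow> z \<in> Q \<Longrightarrow>
      x \<triangleright> (y \<triangleright> z) = (x \<triangleright> y) \<triangleright> (x \<triangleright> z)"

definition (in vector_space) GL :: "('b \<Rightarrow> 'b) set" where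
  "GL = {f. Vector_Spaces.linear scale scale f \<and> bij f}"

definition (in vector_space) ordered_basis :: "'b list \<Rightarrow> bool" where
  "ordered_basis bs \<longleftrightarrow> distinct bs \<and> independent (set bs) \<and> span (set bs) = UNIV"

text \<open>The matrix of \<open>f\<close> with respect to \<open>bs\<close> in the domain and \<open>cs\<close> in the codomain;
  column \<open>j\<close> holds the coordinates of the image of the basis vector \<open>bs ! j\<close>.\<close>

definition (in vector_space) matrix_of :: "'b list \<Rightarrow> 'b list \<Rightarrow> ('b \<Rightarrow> 'b) \<Rightarrow> 'a mat" where
  "matrix_of bs cs f =
     mat (length cs) (length bs) (\<lambda>(i, j). representation (set cs) (f (bs ! j)) (cs ! i))"

text \<open>Meaningful for linear endomorphisms of a finite dimensional space only; the value does not
  depend on the chosen basis, see \<open>endo_det_eq\<close> below.\<close>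

definition (in vector_space) endo_det :: "('b \<Rightarrow> 'b) \<Rightarrow> 'a" where
  "endo_det f = (let bs = (SOME bs. ordered_basis bs) in Determinant.det (matrix_of bs bs f))"

lemma (in vector_space) ordered_basis_length_eq:
  assumes "ordered_basis bs" "ordered_basis cs"
  shows "length bs = length cs"
proof -
  have "card (set bs) = dim UNIV" "card (set cs) = dim UNIV"
    using assms dim_eq_card[of "set bs" UNIV] dim_eq_card[of "set cs" UNIV]
    by (auto simp: ordered_basis_def)
  then show ?thesis
    using assms by (simp add: ordered_basis_def distinct_card)
qed

lemma (in vector_space) matrix_of_comp:
  assumes cs: "ordered_basis cs" and ds: "ordered_basis ds"
    and g: "Vector_Spaces.linear scale scale g"
  shows "matrix_of bs ds (g \<circ> f) = matrix_of cs ds g * matrix_of bs cs f"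
proof (rule eq_matI)
  interpret g: Vector_Spaces.linear scale scale g by (rule g)
  have ic: "independent (set cs)" "span (set cs) = UNIV" "distinct cs"
    and id: "independent (set ds)" "span (set ds) = UNIV"
    using cs ds by (auto simp: ordered_basis_def)
  fix i j
  assume "i < dim_row (matrix_of cs ds g * matrix_of bs cs f)"
    and "j < dim_col (matrix_of cs ds g * matrix_of bs cs f)"
  then have ij: "i < length ds" "j < length bs"
    by (auto simp: matrix_of_def)
  let ?v = "f (bs ! j)"
  let ?r = "representation (set cs) ?v"
  have "g ?v = g (\<Sum>c\<in>set cs. scale (?r c) c)"
    using ic by (subst sum_representation_eq) auto
  also have "\<dots> = (\<Sum>c\<in>set cs. scale (?r c) (g c))"
    by (simp add: g.sum g.scale)
  also have "representation (set ds) \<dots> (ds ! i)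
      = (\<Sum>c\<in>set cs. ?r c * representation (set ds) (g c) (ds ! i))"
    using id by (simp add: representation_sum representation_scale)
  also have "\<dots> = (\<Sum>k\<in>{0..<length cs}. ?r (cs ! k) * representation (set ds) (g (cs ! k)) (ds ! i))"
    using bij_betw_nth[OF ic(3), of "{0..<length cs}" "set cs"]
    by (intro sum.reindex_bij_betw[symmetric]) (auto simp: lessThan_atLeast0)
  finally show "matrix_of bs ds (g \<circ> f) $$ (i, j) = (matrix_of cs ds g * matrix_of bs cs f) $$ (i, j)"
    using ij by (simp add: matrix_of_def scalar_prod_def mult.commute)
qed (auto simp: matrix_of_def)

lemma (in vector_space) matrix_of_id:
  assumes "ordered_basis bs"
  shows "matrix_of bs bs id = 1\<^sub>m (length bs)"
  using assms
  by (intro eq_matI) (auto simp: matrix_of_def ordered_basis_def representation_basis nth_eq_iff_index_eq)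

lemma (in vector_space) endo_det_eq:
  assumes bs: "ordered_basis bs" and f: "Vector_Spaces.linear scale scale f"
  shows "endo_det f = Determinant.det (matrix_of bs bs f)"
proof -
  define cs where "cs = (SOME cs. ordered_basis cs)"
  define n where "n = length bs"
  have cs: "ordered_basis cs"
    unfolding cs_def using bs by (rule someI)
  have len: "length bs = n" "length cs = n"
    using ordered_basis_length_eq[OF bs cs] by (simp_all add: n_def)
  have carrier: "matrix_of bs cs h \<in> carrier_mat n n" "matrix_of cs bs h \<in> carrier_mat n n"
    "matrix_of bs bs h \<in> carrier_mat n n" for h
    by (simp_all add: matrix_of_def len)
  have lid: "Vector_Spaces.linear scale scale id"
    by (rule linear_id)
  have "matrix_of cs cs f = matrix_of bs cs id * (matrix_of bs bs f * matrix_of cs bs id)"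
    using matrix_of_comp[OF bs cs lid, of cs "f \<circ> id"] matrix_of_comp[OF bs bs f, of cs id] by simp
  then have "Determinant.det (matrix_of cs cs f) =
      Determinant.det (matrix_of bs cs id) * Determinant.det (matrix_of cs bs id) * Determinant.det (matrix_of bs bs f)"
    using carrier by (simp add: det_mult[where n = n] mult_carrier_mat[of _ n n])
  also have "Determinant.det (matrix_of bs cs id) * Determinant.det (matrix_of cs bs id) =
      Determinant.det (matrix_of bs cs id * matrix_of cs bs id)"
    using carrier by (simp add: det_mult[where n = n])
  also have "matrix_of bs cs id * matrix_of cs bs id = 1\<^sub>m n"
    using matrix_of_comp[OF bs cs lid, of cs id] matrix_of_id[OF cs] len by simp
  finally show ?thesis
    by (simp add: endo_det_def cs_def)
qed

lemma (in finite_dimensional_vector_space) ex_ordered_basis: "\<exists>bs. ordered_basis bs"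
  using finite_distinct_list[OF finite_Basis] independent_Basis span_Basis
  by (auto simp: ordered_basis_def)

locale quandle_representation =
  quandle Q op + vector_space scale
  for Q :: "'q set" and op :: "'q \<Rightarrow> 'q \<Rightarrow> 'q" (infixr "\<triangleright>" 70)
    and scale :: "'k::field \<Rightarrow> 'v::ab_group_add \<Rightarrow> 'v" +
  fixes \<rho> :: "'q \<Rightarrow> 'v \<Rightarrow> 'v"
  assumes rep_GL: "x \<in> Q \<Longrightarrow> \<rho> x \<in> GL"
    and rep_conj: "x \<in> Q \<Longrightarrow> y \<in> Q \<Longrightarrow> \<rho> (x \<triangleright> y) = \<rho> x \<circ> \<rho> y \<circ> inv_into UNIV (\<rho> x)"
begin

text \<open>As in the usual wording ``the only stable subspaces are \<open>0\<close> and \<open>V\<close>'', the zero space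
  is not excluded.\<close>

definition irreducible_rep :: bool where
  "irreducible_rep \<longleftrightarrow>
     (\<forall>W. subspace W \<and> (\<forall>x\<in>Q. \<rho> x ` W \<subseteq> W) \<longrightarrow> W = {0} \<or> W = UNIV)"

text \<open>The maps \<open>\<rho> x\<close> are linear bijections, so being an isometry amounts to preserving \<open>ip\<close>.\<close>

definition unitary_for :: "('v \<Rightarrow> 'v \<Rightarrow> 'k) \<Rightarrow> bool" where
  "unitary_for ip \<longleftrightarrow> (\<forall>x\<in>Q. \<forall>v w. ip (\<rho> x v) (\<rho> x w) = ip v w)"

end

text \<open>Complex (Hermitian) inner products, linear in the first argument. By conjugate symmetry
  \<open>ip v v\<close> is real, so that positivity can be stated for its real part.\<close>

locale complex_inner_product = vector_space scale
  for scale :: "complex \<Rightarrow> 'v::ab_group_add \<Rightarrow> 'v" +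
  fixes ip :: "'v \<Rightarrow> 'v \<Rightarrow> complex"
  assumes add_left: "ip (u + v) w = ip u w + ip v w"
    and scale_left: "ip (scale c v) w = c * ip v w"
    and conj_sym: "ip w v = cnj (ip v w)"
    and pos_def: "v \<noteq> 0 \<Longrightarrow> 0 < Re (ip v v)"

end

theory Submission
  imports Defs "Jordan_Normal_Form.Spectral_Radius"
begin

text \<open>Conjugation by an element of the monoid \<open>G\<close> generated by \<open>\<rho> ` Q\<close> permutes the finite set
  \<open>\<rho> ` Q\<close>, and by Schur's lemma two elements of \<open>G\<close> inducing the same permutation differ by a
  scalar. If all determinants have modulus 1, so has this scalar; hence a fixed inner product has
  only finitely many pullbacks along elements of \<open>G\<close>. Their sum is a positive definite form, and
  it is invariant because pulling back along \<open>\<rho> x\<close> permutes the summands.\<close>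

section \<open>Determinants and eigenvectors of endomorphisms\<close>

context finite_dimensional_vector_space
begin

lemma endo_det_comp:
  assumes f: "Vector_Spaces.linear scale scale f" and g: "Vector_Spaces.linear scale scale g"
  shows "endo_det (g \<circ> f) = endo_det g * endo_det f"
proof -
  obtain bs where bs: "ordered_basis bs"
    using ex_ordered_basis by blast
  have "matrix_of bs bs h \<in> carrier_mat (length bs) (length bs)" for h
    by (simp add: matrix_of_def)
  then show ?thesis
    using bs f g
    by (simp add: endo_det_eq[of bs] Vector_Spaces.linear_compose[OF f g] matrix_of_comp[of bs bs]
        det_mult[of _ "length bs"])
qed

lemma endo_det_id: "endo_det id = 1"
proof -
  obtain bs where "ordered_basis bs"
    using ex_ordered_basis by blast
  then show ?thesis
    by (simp add: endo_det_eq[of bs] linear_id matrix_of_id)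
qed

lemma endo_det_scale: "endo_det (scale c) = c ^ dimension"
proof -
  obtain bs where bs: "ordered_basis bs"
    using ex_ordered_basis by blast
  have len: "length bs = dimension"
    using bs dim_eq_card[of "set bs" UNIV]
    by (auto simp: ordered_basis_def distinct_card dimension_def)
  have "matrix_of bs bs (scale c) = c \<cdot>\<^sub>m 1\<^sub>m (length bs)"
    using bs
    by (intro eq_matI)
      (auto simp: matrix_of_def ordered_basis_def representation_scale representation_basis
        span_base nth_eq_iff_index_eq)
  then show ?thesis
    using bs by (simp add: endo_det_eq[of bs] len)
qed

text \<open>A linear left inverse exists, so by multiplicativity the determinant is a unit.\<close>

lemma endo_det_nonzero_if_inj:
  assumes f: "Vector_Spaces.linear scale scale f" and "inj f"
  shows "endo_det f \<noteq> 0"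
proof -
  interpret pair: vector_space_pair scale scale ..
  obtain g where g: "Vector_Spaces.linear scale scale g" "g \<circ> f = id"
    using pair.linear_injective_left_inverse[OF assms] by blast
  then have "endo_det g * endo_det f = 1"
    using endo_det_comp[OF f g(1)] by (simp add: endo_det_id)
  then show ?thesis
    by auto
qed

end

text \<open>A complex matrix of positive size has an eigenvalue \<open>e\<close>. Then
  \<open>f - e\<close> has determinant 0 and so is not injective; a nonzero kernel vector is the
  eigenvector.\<close>

lemma complex_eigenvector_exists:
  fixes scale :: "complex \<Rightarrow> 'v::ab_group_add \<Rightarrow> 'v"
  assumes fd: "finite_dimensional_vector_space scale Basis"
    and f: "Vector_Spaces.linear scale scale f"
    and nontriv: "(UNIV :: 'v set) \<noteq> {0}"
  shows "\<exists>e v. v \<noteq> 0 \<and> f v = scale e v"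
proof -
  interpret finite_dimensional_vector_space scale Basis by (rule fd)
  interpret pair: vector_space_pair scale scale ..
  obtain bs where bs: "ordered_basis bs"
    using ex_ordered_basis by blast
  define n where "n = length bs"
  define A where "A = matrix_of bs bs f"
  have A: "A \<in> carrier_mat n n"
    by (simp add: A_def n_def matrix_of_def)
  have "n \<noteq> 0"
    using bs nontriv by (auto simp: n_def ordered_basis_def)
  then obtain e where "eigenvalue A e"
    using spectrum_non_empty[OF A] by (auto simp: spectrum_def)
  then have det0: "Determinant.det (char_matrix A e) = 0"
    using eigenvalue_det[OF A] by simp
  let ?g = "\<lambda>v. f v - scale e v"
  have g: "Vector_Spaces.linear scale scale ?g"
    using f by (intro pair.linear_compose_sub linear_scale_self)
  \<comment> \<open>\<open>char_matrix A e\<close> is \<open>A\<close> minus \<open>e\<close> times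
    the identity, which is the matrix of \<open>?g\<close>.\<close>
  have "matrix_of bs bs ?g = char_matrix A e"
    using bs
    by (intro eq_matI)
      (auto simp: matrix_of_def char_matrix_def A_def ordered_basis_def representation_diff
        representation_scale representation_basis span_base nth_eq_iff_index_eq)
  then have "endo_det ?g = 0"
    using det0 by (simp add: endo_det_eq[OF bs g])
  then have "\<not> inj ?g"
    using endo_det_nonzero_if_inj[OF g] by auto
  then obtain v where "v \<noteq> 0" "?g v = 0"
    using pair.linear_inj_iff_eq_0[OF g] by blast
  then show ?thesis
    by auto
qed

section \<open>Inner products and determinants of isometries\<close>

context complex_inner_product
begin

lemma zero_left: "ip 0 w = 0"
  using scale_left[of 0 0 w] by simp

lemma sum_left: "ip (\<Sum>i\<in>I. g i) w = (\<Sum>i\<in>I. ip (g i) w)"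
  by (induction I rule: infinite_finite_induct) (auto simp: add_left zero_left)

lemma sum_right: "ip w (\<Sum>i\<in>I. g i) = (\<Sum>i\<in>I. ip w (g i))"
  by (subst (1 2) conj_sym) (simp add: sum_left)

lemma scale_right: "ip w (scale c v) = cnj c * ip w v"
  by (subst (1 2) conj_sym) (simp add: scale_left)

end

text \<open>The matrix \<open>A\<close> of an isometry satisfies \<open>A\<^sup>* M A = M\<close> for the Gram matrix \<open>M\<close>, which is
  invertible, being the matrix of the injective map sending \<open>v\<close> to the sum of all
  \<open>\<langle>v, b\<rangle> b\<close>.\<close>

lemma isometry_cmod_det:
  fixes scale :: "complex \<Rightarrow> 'v::ab_group_add \<Rightarrow> 'v"
  assumes fd: "finite_dimensional_vector_space scale Basis"
    and ip: "complex_inner_product scale ip"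
    and f: "Vector_Spaces.linear scale scale f"
    and isometry: "\<And>v w. ip (f v) (f w) = ip v w"
  shows "cmod (vector_space.endo_det scale f) = 1"
proof -
  interpret finite_dimensional_vector_space scale Basis by (rule fd)
  interpret pair: vector_space_pair scale scale ..
  interpret complex_inner_product scale ip by (rule ip)
  obtain bs where bs: "ordered_basis bs"
    using ex_ordered_basis by blast
  define n where "n = length bs"
  have bs': "distinct bs" "independent (set bs)" "span (set bs) = UNIV"
    using bs by (auto simp: ordered_basis_def)
  define A where "A = matrix_of bs bs f"
  define T where "T v = (\<Sum>i<n. scale (ip v (bs ! i)) (bs ! i))" for v
  define M where "M = matrix_of bs bs T"
  define B where "B = map_mat cnj (transpose_mat A)"
  have carrier: "A \<in> carrier_mat n n" "M \<in> carrier_mat n n" "B \<in> carrier_mat n n"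
    by (simp_all add: A_def M_def B_def n_def matrix_of_def)
  have T: "Vector_Spaces.linear scale scale T"
    by (simp add: Vector_Spaces.linear_iff vector_space_axioms T_def add_left scale_left
        scale_left_distrib sum.distrib scale_sum_right)
  have coord_sum: "representation (set bs) (\<Sum>i<n. scale (a i) (bs ! i)) (bs ! j) = a j"
    if "j < n" for a j
    using bs' that
    by (simp add: representation_sum representation_scale span_base representation_basis n_def
        nth_eq_iff_index_eq if_distrib[of "(*) _"] cong: if_cong)
  have expand: "v = (\<Sum>i<n. scale (representation (set bs) v (bs ! i)) (bs ! i))" for v
  proof -
    have "v = (\<Sum>b\<in>set bs. scale (representation (set bs) v b) b)"
      using bs' by (subst sum_representation_eq) auto
    also have "\<dots> = (\<Sum>i<n. scale (representation (set bs) v (bs ! i)) (bs ! i))"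
      using bij_betw_nth[OF bs'(1), of "{..<n}" "set bs"]
      by (intro sum.reindex_bij_betw[symmetric]) (auto simp: n_def)
    finally show ?thesis .
  qed
  have "inj T"
    unfolding pair.linear_inj_iff_eq_0[OF T]
  proof (intro allI impI)
    fix v assume "T v = 0"
    \<comment> \<open>The coordinates of \<open>T v\<close> are the products of \<open>v\<close>
      with the basis vectors. If all vanish, \<open>v\<close> is orthogonal to the whole space, in
      particular to itself.\<close>
    then have z: "ip v (bs ! i) = 0" if "i < n" for i
      using coord_sum[OF that, of "\<lambda>i. ip v (bs ! i)"] by (simp add: T_def representation_zero)
    have "ip v v = (\<Sum>i<n. cnj (representation (set bs) v (bs ! i)) * ip v (bs ! i))"
      by (subst (2) expand[of v]) (simp add: sum_right scale_right)
    also have "\<dots> = 0"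
      using z by simp
    finally show "v = 0"
      using pos_def[of v] by auto
  qed
  then have M0: "Determinant.det M \<noteq> 0"
    using endo_det_nonzero_if_inj[OF T] by (simp add: M_def endo_det_eq[OF bs T])
  have M_entry: "M $$ (i, j) = ip (bs ! j) (bs ! i)" if "i < n" "j < n" for i j
    using that by (simp add: M_def matrix_of_def n_def[symmetric] T_def coord_sum)
  have A_col: "f (bs ! j) = (\<Sum>i<n. scale (A $$ (i, j)) (bs ! i))" if "j < n" for j
    using that by (subst expand) (auto simp: A_def matrix_of_def n_def intro!: sum.cong)
  have "M = B * (M * A)"
  proof (rule eq_matI)
    fix i j assume "i < dim_row (B * (M * A))" "j < dim_col (B * (M * A))"
    then have ij: "i < n" "j < n"
      using carrier by auto
    have "M $$ (i, j) = ip (f (bs ! j)) (f (bs ! i))"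
      using ij by (simp add: M_entry isometry)
    also have "\<dots> = (\<Sum>l<n. cnj (A $$ (l, i)) * (\<Sum>k<n. A $$ (k, j) * ip (bs ! k) (bs ! l)))"
      using ij by (simp add: A_col sum_left sum_right scale_left scale_right)
    also have "\<dots> = (B * (M * A)) $$ (i, j)"
      using ij carrier
      by (simp add: scalar_prod_def B_def M_entry lessThan_atLeast0 mult.commute)
    finally show "M $$ (i, j) = (B * (M * A)) $$ (i, j)" .
  qed (use carrier in auto)
  then have "Determinant.det M = Determinant.det B * (Determinant.det M * Determinant.det A)"
    using carrier by (metis det_mult mult_carrier_mat)
  then have *: "Determinant.det B * Determinant.det A = 1"
    using M0 by simp
  \<comment> \<open>Ring homomorphisms commute with determinants; applied to conjugation, this
    evaluates the determinant of \<open>B\<close>.\<close>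
  interpret cnj: comm_ring_hom cnj
    by unfold_locales auto
  have "Determinant.det B = cnj (Determinant.det A)"
    using carrier by (simp add: B_def det_transpose)
  then have "(cmod (Determinant.det A))\<^sup>2 = 1"
    using * by (metis complex_norm_square mult.commute of_real_eq_1_iff)
  then show ?thesis
    using norm_ge_zero[of "Determinant.det A"]
    by (auto simp: endo_det_eq[OF bs f] A_def power2_eq_1_iff simp del: norm_ge_zero)
qed

text \<open>Declare \<open>Basis\<close> orthonormal. Positivity holds because a nonzero vector has
  a nonzero coordinate.\<close>

lemma complex_inner_product_exists:
  fixes scale :: "complex \<Rightarrow> 'v::ab_group_add \<Rightarrow> 'v"
  assumes fd: "finite_dimensional_vector_space scale Basis"
  shows "\<exists>ip. complex_inner_product scale ip"
proof -
  interpret finite_dimensional_vector_space scale Basis by (rule fd)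
  let ?r = "representation Basis"
  define ip where "ip v w = (\<Sum>b\<in>Basis. ?r v b * cnj (?r w b))" for v w
  have "complex_inner_product scale ip"
  proof
    fix v :: 'v assume v: "v \<noteq> 0"
    have "\<exists>b\<in>Basis. ?r v b \<noteq> 0"
    proof (rule ccontr)
      assume "\<not> ?thesis"
      then have "(\<Sum>b\<in>Basis. scale (?r v b) b) = 0"
        by simp
      with v show False
        using sum_representation_eq[OF independent_Basis _ finite_Basis] span_Basis by auto
    qed
    then have "0 < (\<Sum>b\<in>Basis. (cmod (?r v b))\<^sup>2)"
      using finite_Basis by (auto intro!: sum_pos2)
    also have "\<dots> = Re (ip v v)"
      by (simp add: ip_def complex_mult_cnj cmod_power2)
    finally show "0 < Re (ip v v)" .
  qed (auto simp: ip_def representation_add representation_scale independent_Basis span_Basis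
      sum.distrib sum_distrib_left algebra_simps)
  then show ?thesis
    by blast
qed

section \<open>Schur's lemma and the monoid generated by the representation\<close>

locale irreducible_complex_quandle_rep =
  quandle_representation Q op scale \<rho> + finite_dimensional_vector_space scale Basis
  for Q :: "'q set" and op :: "'q \<Rightarrow> 'q \<Rightarrow> 'q" (infixr "\<triangleright>" 70)
    and scale :: "complex \<Rightarrow> 'v::ab_group_add \<Rightarrow> 'v" and \<rho> :: "'q \<Rightarrow> 'v \<Rightarrow> 'v"
    and Basis :: "'v set" +
  assumes irred: "irreducible_rep"
begin

lemma rep_linear: "x \<in> Q \<Longrightarrow> Vector_Spaces.linear scale scale (\<rho> x)"
  and rep_bij: "x \<in> Q \<Longrightarrow> bij (\<rho> x)"
  using rep_GL by (auto simp: GL_def)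

text \<open>An eigenspace of \<open>f\<close> is stable under every \<open>\<rho> x\<close> and
  nonzero, hence everything by irreducibility.\<close>

lemma schur:
  assumes f: "Vector_Spaces.linear scale scale f"
    and comm: "\<And>x. x \<in> Q \<Longrightarrow> f \<circ> \<rho> x = \<rho> x \<circ> f"
  shows "\<exists>e. f = scale e"
proof (cases "(UNIV :: 'v set) = {0}")
  \<comment> \<open>The zero space counts as irreducible but has no eigenvectors; there every map is
    multiplication by 1.\<close>
  case True
  then have "f v = scale 1 v" for v
    by (metis UNIV_I singletonD)
  then show ?thesis
    by blast
next
  case False
  obtain e v where v: "v \<noteq> 0" "f v = scale e v"
    using complex_eigenvector_exists[OF finite_dimensional_vector_space_axioms f False] by blast
  define W where "W = {v. f v = scale e v}"
  interpret f: Vector_Spaces.linear scale scale f by (rule f)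
  have "subspace W"
    by (auto simp: W_def subspace_def f.add f.scale scale_right_distrib mult.commute)
  moreover have "\<rho> x ` W \<subseteq> W" if x: "x \<in> Q" for x
  proof -
    interpret r: Vector_Spaces.linear scale scale "\<rho> x" by (rule rep_linear[OF x])
    show ?thesis
      using fun_cong[OF comm[OF x]] by (auto simp: W_def r.scale)
  qed
  ultimately have "W = {0} \<or> W = UNIV"
    using irred by (auto simp: irreducible_rep_def)
  then show ?thesis
    using v by (auto simp: W_def)
qed

text \<open>Words grow on the right because pulling a form back along \<open>g\<close> and then
  along \<open>\<rho> x\<close> is pulling it back along \<open>g \<circ> \<rho> x\<close>.\<close>

inductive_set rep_monoid :: "('v \<Rightarrow> 'v) set" where
  id_rep_monoid: "id \<in> rep_monoid"
| comp_rep_monoid: "g \<in> rep_monoid \<Longrightarrow> x \<in> Q \<Longrightarrow> g \<circ> \<rho> x \<in> rep_monoid"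

lemma rep_monoid_linear: "g \<in> rep_monoid \<Longrightarrow> Vector_Spaces.linear scale scale g"
  by (induction rule: rep_monoid.induct)
    (blast intro: linear_id Vector_Spaces.linear_compose[OF rep_linear])+

lemma rep_monoid_bij: "g \<in> rep_monoid \<Longrightarrow> bij g"
  by (induction rule: rep_monoid.induct) (intro bij_id bij_comp rep_bij; assumption)+

lemma rep_monoid_cmod_det:
  assumes "\<And>x. x \<in> Q \<Longrightarrow> cmod (endo_det (\<rho> x)) = 1"
  shows "g \<in> rep_monoid \<Longrightarrow> cmod (endo_det g) = 1"
proof (induction rule: rep_monoid.induct)
  case id_rep_monoid
  show ?case
    unfolding endo_det_id by simp
next
  case (comp_rep_monoid g x)
  then show ?case
    unfolding endo_det_comp[OF rep_linear rep_monoid_linear, OF comp_rep_monoid.hyps(2,1)]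
    by (simp add: norm_mult assms)
qed

text \<open>For a single \<open>\<rho> x\<close> this is the representation law together with
  closure of \<open>Q\<close>. In a word the last letter conjugates first, so the induction must
  allow any \<open>r\<close>.\<close>

lemma rep_monoid_conj:
  "g \<in> rep_monoid \<Longrightarrow> r \<in> \<rho> ` Q \<Longrightarrow> g \<circ> r \<circ> inv_into UNIV g \<in> \<rho> ` Q"
proof (induction arbitrary: r rule: rep_monoid.induct)
  case (comp_rep_monoid g x)
  then have "\<rho> x \<circ> r \<circ> inv_into UNIV (\<rho> x) \<in> \<rho> ` Q"
    by (metis (no_types, lifting) closed imageE imageI rep_conj)
  then have "g \<circ> (\<rho> x \<circ> r \<circ> inv_into UNIV (\<rho> x)) \<circ> inv_into UNIV g \<in> \<rho> ` Q"
    by (rule comp_rep_monoid.IH)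
  then show ?case
    unfolding o_inv_distrib[OF rep_monoid_bij rep_bij, OF comp_rep_monoid.hyps] o_assoc .
qed simp

text \<open>By Schur's lemma, elements inducing the same conjugation on \<open>\<rho> ` Q\<close> differ by a scalar,
  whose modulus is 1 because of the determinants.\<close>

lemma same_conj_imp_unit_multiple:
  assumes det: "\<And>x. x \<in> Q \<Longrightarrow> cmod (endo_det (\<rho> x)) = 1"
    and g: "g \<in> rep_monoid" and h: "h \<in> rep_monoid"
    and same: "\<And>x. x \<in> Q \<Longrightarrow> g \<circ> \<rho> x \<circ> inv_into UNIV g = h \<circ> \<rho> x \<circ> inv_into UNIV h"
  shows "\<exists>c. cmod c = 1 \<and> g = h \<circ> scale c"
proof (cases "(UNIV :: 'v set) = {0}")
  \<comment> \<open>In dimension 0 the determinant says nothing about the scalar, so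
    \<open>c = 1\<close> is chosen by hand.\<close>
  case True
  then have "g = h \<circ> scale 1"
    by (intro ext) (metis UNIV_I singletonD)
  then show ?thesis
    by (intro exI[of _ 1]) simp
next
  case False
  note bg = rep_monoid_bij[OF g] and bh = rep_monoid_bij[OF h]
  have "Vector_Spaces.linear scale scale (inv_into UNIV h)"
    using inj_linear_imp_inv_linear[OF rep_monoid_linear[OF h]] bh by (simp add: bij_def)
  then have "Vector_Spaces.linear scale scale (inv_into UNIV h \<circ> g)"
    using Vector_Spaces.linear_compose rep_monoid_linear[OF g] by blast
  moreover have "(inv_into UNIV h \<circ> g) \<circ> \<rho> x = \<rho> x \<circ> (inv_into UNIV h \<circ> g)" if "x \<in> Q" for x
  proof
    fix v
    \<comment> \<open>Evaluating the equal conjugations at \<open>g v\<close> cancels the inverse of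
      \<open>g\<close>.\<close>
    have "g (\<rho> x v) = h (\<rho> x (inv_into UNIV h (g v)))"
      using fun_cong[OF same[OF that], of "g v"] bg by (simp add: bij_def)
    then show "((inv_into UNIV h \<circ> g) \<circ> \<rho> x) v = (\<rho> x \<circ> (inv_into UNIV h \<circ> g)) v"
      using bh by (simp add: bij_def)
  qed
  ultimately obtain c where "inv_into UNIV h \<circ> g = scale c"
    using schur by blast
  then have gh: "g = h \<circ> scale c"
    using bh by (metis bij_def comp_assoc id_comp surj_iff)
  \<comment> \<open>The determinants of \<open>g\<close> and \<open>h\<close> have modulus 1 and
    differ by the factor \<open>c ^ dimension\<close>.\<close>
  have "cmod c ^ dimension = cmod (endo_det (scale c))"
    by (simp add: endo_det_scale norm_power)
  also have "\<dots> = 1"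
    using endo_det_comp[OF linear_scale_self rep_monoid_linear[OF h], of c]
      rep_monoid_cmod_det[OF det g] rep_monoid_cmod_det[OF det h]
    by (simp add: gh[symmetric] norm_mult)
  finally have "cmod c ^ dimension = 1" .
  moreover have "dimension \<noteq> 0"
    using False span_Basis finite_Basis by (auto simp: dimension_def)
  ultimately have "cmod c = 1"
    using power_eq_1_iff[of "cmod c" dimension] by simp
  with gh show ?thesis
    by blast
qed

section \<open>Construction of the invariant inner product\<close>

theorem unitarizable:
  assumes fin: "finite Q"
    and det: "\<And>x. x \<in> Q \<Longrightarrow> cmod (endo_det (\<rho> x)) = 1"
  shows "\<exists>ip. complex_inner_product scale ip \<and> unitary_for ip"
proof -
  obtain ip0 where ip0: "complex_inner_product scale ip0"
    using complex_inner_product_exists[OF finite_dimensional_vector_space_axioms] by blast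
  interpret ip0: complex_inner_product scale ip0 by (rule ip0)
  interpret pair: vector_space_pair scale scale ..
  define pull where "pull g = (\<lambda>v w. ip0 (g v) (g w))" for g :: "'v \<Rightarrow> 'v"
  \<comment> \<open>The sum will run over the set of forms, each counted once: the monoid may be
    infinite, but this set is finite.\<close>
  define S where "S = pull ` rep_monoid"
  define act where "act g = (\<lambda>r\<in>\<rho> ` Q. g \<circ> r \<circ> inv_into UNIV g)" for g :: "'v \<Rightarrow> 'v"
  have pull_eq: "pull g = pull h"
    if g: "g \<in> rep_monoid" and h: "h \<in> rep_monoid" and eq: "act g = act h" for g h
  proof -
    have "g \<circ> \<rho> x \<circ> inv_into UNIV g = h \<circ> \<rho> x \<circ> inv_into UNIV h" if "x \<in> Q" for x
      using fun_cong[OF eq, of "\<rho> x"] that by (simp add: act_def)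
    then obtain c where c: "cmod c = 1" "g = h \<circ> scale c"
      using same_conj_imp_unit_multiple[OF det g h] by blast
    interpret h: Vector_Spaces.linear scale scale h by (rule rep_monoid_linear[OF h])
    have "c * cnj c = 1"
      using c(1) by (simp add: complex_norm_square[symmetric])
    then have "ip0 (scale c v) (scale c w) = ip0 v w" for v w
      unfolding ip0.scale_left ip0.scale_right by (simp add: mult.assoc[symmetric] mult.commute[of "cnj c"])
    then show ?thesis
      by (intro ext) (simp add: pull_def c(2) h.scale)
  qed
  have "act ` rep_monoid \<subseteq> (\<rho> ` Q) \<rightarrow>\<^sub>E (\<rho> ` Q)"
    using rep_monoid_conj by (auto simp: act_def simp del: comp_apply)
  then have fin_act: "finite (act ` rep_monoid)"
    using fin by (meson finite_PiE finite_imageI finite_subset)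
  \<comment> \<open>By \<open>pull_eq\<close> the form depends only on \<open>act g\<close>, so one
    representative per value of \<open>act\<close> yields all of \<open>S\<close>.\<close>
  have "S \<subseteq> (\<lambda>a. pull (inv_into rep_monoid act a)) ` act ` rep_monoid"
  proof
    fix H assume "H \<in> S"
    then obtain g where g: "g \<in> rep_monoid" "H = pull g"
      by (auto simp: S_def)
    have "pull g = pull (inv_into rep_monoid act (act g))"
      using g(1) by (intro pull_eq) (auto simp: inv_into_into f_inv_into_f)
    with g show "H \<in> (\<lambda>a. pull (inv_into rep_monoid act a)) ` act ` rep_monoid"
      by blast
  qed
  then have fin_S: "finite S"
    using fin_act finite_subset by blast
  have S_ne: "S \<noteq> {}"
    using id_rep_monoid by (auto simp: S_def)
  define ip where "ip v w = (\<Sum>H\<in>S. H v w)" for v w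
  have "complex_inner_product scale ip"
  proof
    fix u v w c
    show "ip (u + v) w = ip u w + ip v w"
      unfolding ip_def sum.distrib[symmetric]
      by (rule sum.cong)
        (auto simp: S_def pull_def ip0.add_left pair.linear_add[OF rep_monoid_linear])
    show "ip (scale c v) w = c * ip v w"
      unfolding ip_def sum_distrib_left
      by (rule sum.cong)
        (auto simp: S_def pull_def ip0.scale_left pair.linear_scale[OF rep_monoid_linear])
    show "ip w v = cnj (ip v w)"
      unfolding ip_def cnj_sum
      by (rule sum.cong) (auto simp: S_def pull_def intro: ip0.conj_sym)
    assume v: "v \<noteq> 0"
    have "g v \<noteq> 0" if g: "g \<in> rep_monoid" for g
      using v rep_monoid_bij[OF g] pair.linear_inj_iff_eq_0[OF rep_monoid_linear[OF g]]
      by (auto simp: bij_def)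
    then have "0 < Re (H v v)" if "H \<in> S" for H
      using that ip0.pos_def by (auto simp: S_def pull_def)
    then show "0 < Re (ip v v)"
      unfolding ip_def Re_sum using fin_S S_ne by (intro sum_pos) auto
  qed
  moreover have "ip (\<rho> x v) (\<rho> x w) = ip v w" if x: "x \<in> Q" for x v w
  proof -
    \<comment> \<open>Pullback along \<open>\<rho> x\<close> maps \<open>S\<close> into itself, and
      it is injective since \<open>\<rho> x\<close> is surjective. As \<open>S\<close> is finite, it
      permutes the summands of \<open>ip\<close>.\<close>
    define \<tau> where "\<tau> H = (\<lambda>v w. H (\<rho> x v) (\<rho> x w))" for H :: "'v \<Rightarrow> 'v \<Rightarrow> complex"
    have "\<tau> ` S \<subseteq> S"
    proof
      fix H assume "H \<in> \<tau> ` S"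
      then obtain g where g: "g \<in> rep_monoid" "H = \<tau> (pull g)"
        by (auto simp: S_def)
      then have "H = pull (g \<circ> \<rho> x)"
        by (simp add: \<tau>_def pull_def)
      then show "H \<in> S"
        using comp_rep_monoid[OF g(1) x] by (simp add: S_def)
    qed
    moreover have "inj_on \<tau> S"
    proof (rule inj_onI, intro ext)
      fix H H' v w assume "\<tau> H = \<tau> H'"
      then have "H (\<rho> x (inv_into UNIV (\<rho> x) v)) (\<rho> x (inv_into UNIV (\<rho> x) w))
          = H' (\<rho> x (inv_into UNIV (\<rho> x) v)) (\<rho> x (inv_into UNIV (\<rho> x) w))"
        by (simp add: \<tau>_def fun_eq_iff)
      then show "H v w = H' v w"
        using rep_bij[OF x] by (simp add: bij_def surj_f_inv_f)
    qed
    ultimately have "bij_betw \<tau> S S"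
      using endo_inj_surj[OF fin_S] by (simp add: bij_betw_def)
    then have "(\<Sum>H\<in>S. \<tau> H v w) = (\<Sum>H\<in>S. H v w)"
      by (rule sum.reindex_bij_betw)
    then show ?thesis
      by (simp add: ip_def \<tau>_def)
  qed
  ultimately show ?thesis
    by (auto simp: unitary_for_def)
qed

end

theorem theorem3p1:
  fixes Q :: "'q set" and op :: "'q \<Rightarrow> 'q \<Rightarrow> 'q"
    and scale :: "complex \<Rightarrow> 'v::ab_group_add \<Rightarrow> 'v" and Basis :: "'v set"
    and \<rho> :: "'q \<Rightarrow> 'v \<Rightarrow> 'v"
  assumes "quandle Q op" and "finite Q"
    and "finite_dimensional_vector_space scale Basis"
    and "quandle_representation Q op scale \<rho>"
    and "quandle_representation.irreducible_rep Q scale \<rho>"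
  shows "(\<exists>ip. complex_inner_product scale ip \<and> quandle_representation.unitary_for Q \<rho> ip)
    \<longleftrightarrow> (\<forall>g\<in>\<rho> ` Q. cmod (vector_space.endo_det scale g) = 1)"
proof -
  interpret irreducible_complex_quandle_rep Q op scale \<rho> Basis
    using assms by (simp add: irreducible_complex_quandle_rep_def irreducible_complex_quandle_rep_axioms_def)
  show ?thesis
    using isometry_cmod_det[OF assms(3) _ rep_linear] unitarizable[OF assms(2)]
    by (auto simp: unitary_for_def)
qed

end
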